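(* Let $\Phi\subset\mathbb{R}^3$ be a skew ruled $C^3$-surface, parametrized by $\boldsymbol{x}(u,v)=\boldsymbol{s}(u)+v\,\boldsymbol{e}(u)$, $(u,v)\in I\times\mathbb{R}$, where $\boldsymbol{s}$ is the striction line, $\boldsymbol{e}$ is a unit vector field along the rulings and $u$ is the arclength of the spherical curve $\boldsymbol{e}$. Let $k$, $\delta$, $\sigma$ be its conical curvature, parameter of distribution and striction, and let $\lambda=\cot\sigma$ and $w=\sqrt{v^2+\delta(u)^2}$. Suppose that the normal curvature $k_N$ along the orthogonal trajectories of the rulings has the form $$k_N(u,v)=f(u)\,w^{n}\quad\text{for all }(u,v)\in I\times\mathbb{R},$$ for some integer $n\in\mathbb{Z}$ and some continuous function $f:I\to\mathbb{R}$. Then one of the following occurs: (a) $f=0$ (identically) and $\Phi$ is a right helicoid; (b) $n=-3$, $f(u)=-\delta^2(u)\,\lambda(u)$ for all $u\in I$, and $\Phi$ is a conoidal ruled surface of constant parameter of distribution; (c) $n=-1$, $f(u)=-k(u)$ for all $u\in I$, and $\Phi$ is an orthoid ruled surface of constant parameter of distribution.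
   Context: Setting. $I\subset\mathbb{R}$ is an open interval. A skew ruled $C^3$-surface $\Phi$ is a regular ruled surface of class $C^3$ without torsal rulings, parametrized on $I\times\mathbb{R}$ by $\boldsymbol{x}(u,v)=\boldsymbol{s}(u)+v\,\boldsymbol{e}(u)$ with $|\boldsymbol{e}|=1$, $|\boldsymbol{e}'|=1$ and $\langle\boldsymbol{s}',\boldsymbol{e}'\rangle=0$ on $I$ (so $\boldsymbol{s}$ is the striction line and $u$ is the arclength of $\boldsymbol{e}$); prime denotes $d/du$. Its invariants are: the conical curvature $k=(\boldsymbol{e},\boldsymbol{e}',\boldsymbol{e}'')$ and the parameter of distribution $\delta=(\boldsymbol{e},\boldsymbol{e}',\boldsymbol{s}')$ (both triple products), the striction $\sigma=\sphericalangle(\boldsymbol{e},\boldsymbol{s}')$ with $-\pi/2<\sigma\le\pi/2$ and $\operatorname{sign}\sigma=\operatorname{sign}\delta$, and $\lambda:=\cot\sigma$, so that $\boldsymbol{s}'=\delta\lambda\,\boldsymbol{e}+\delta\,\boldsymbol{e}\times\boldsymbol{e}'$. Skewness means $\delta(u)\neq0$ for all $u\in I$. The unit normal is $(\boldsymbol{x}_u\times\boldsymbol{x}_v)/|\boldsymbol{x}_u\times\boldsymbol{x}_v|$. The normal curvature at $(u,v)$ in direction $du:dv$ is $$k_N=\frac1w\cdot\frac{-[kv^2+\delta' v+\delta^2(k-\lambda)]\,du^2+2\delta\,du\,dv}{[v^2+\delta^2(\lambda^2+1)]\,du^2+2\delta\lambda\,du\,dv+dv^2}.$$ The orthogonal trajectories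 of the rulings are determined by $\delta\lambda\,du+dv=0$. A ruled surface is orthoid if its rulings are perpendicular to the striction line, i.e. $\lambda=0$ on $I$. It is conoidal if its rulings are parallel to a fixed plane, i.e. $k=0$ on $I$. Constant parameter of distribution means $\delta'=0$ on $I$. A right helicoid is characterized by $k=\lambda=\delta'=0$ on $I$. *)

theory Defs
  imports "HOL-Analysis.Analysis"
begin

text \<open>Class \<open>C\<^sup>k\<close> on an open set. Instead of the iterated Frechet derivative, whose type changes
  with the order, all directional derivatives \<open>p \<mapsto> D p h\<close> are required to be of class
  \<open>C\<^sup>k\<^sup>-\<^sup>1\<close>; on a finite-dimensional domain this is the same condition.\<close>

primrec C_k_on :: "nat \<Rightarrow> ('a::euclidean_space \<Rightarrow> 'b::real_normed_vector) \<Rightarrow> 'a set \<Rightarrow> bool" where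
  "C_k_on 0 f S \<longleftrightarrow> continuous_on S f"
| "C_k_on (Suc k) f S \<longleftrightarrow>
     (\<exists>D. (\<forall>p\<in>S. (f has_derivative D p) (at p)) \<and> (\<forall>h. C_k_on k (\<lambda>p. D p h) S))"

abbreviation vderiv :: "(real \<Rightarrow> real^3) \<Rightarrow> real \<Rightarrow> real^3" where
  "vderiv c u \<equiv> vector_derivative c (at u)"

definition triple_product :: "real^3 \<Rightarrow> real^3 \<Rightarrow> real^3 \<Rightarrow> real" where
  "triple_product a b c = a \<bullet> cross3 b c"


subsection \<open>Parametrized surfaces\<close>

definition partial_u :: "(real \<times> real \<Rightarrow> real^3) \<Rightarrow> real \<times> real \<Rightarrow> real^3" where
  "partial_u x p = vderiv (\<lambda>t. x (t, snd p)) (fst p)"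

definition partial_v :: "(real \<times> real \<Rightarrow> real^3) \<Rightarrow> real \<times> real \<Rightarrow> real^3" where
  "partial_v x p = vderiv (\<lambda>t. x (fst p, t)) (snd p)"

definition unit_normal :: "(real \<times> real \<Rightarrow> real^3) \<Rightarrow> real \<times> real \<Rightarrow> real^3" where
  "unit_normal x p =
     cross3 (partial_u x p) (partial_v x p) /\<^sub>R norm (cross3 (partial_u x p) (partial_v x p))"

definition tangent_vector :: "(real \<times> real \<Rightarrow> real^3) \<Rightarrow> real \<times> real \<Rightarrow> real \<Rightarrow> real \<Rightarrow> real^3" where
  "tangent_vector x p du dv = du *\<^sub>R partial_u x p + dv *\<^sub>R partial_v x p"

definition first_form :: "(real \<times> real \<Rightarrow> real^3) \<Rightarrow> real \<times> real \<Rightarrow> real \<Rightarrow> real \<Rightarrow> real" where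
  "first_form x p du dv = tangent_vector x p du dv \<bullet> tangent_vector x p du dv"

definition second_form :: "(real \<times> real \<Rightarrow> real^3) \<Rightarrow> real \<times> real \<Rightarrow> real \<Rightarrow> real \<Rightarrow> real" where
  "second_form x p du dv =
     (partial_u (partial_u x) p \<bullet> unit_normal x p) * du\<^sup>2
     + 2 * (partial_v (partial_u x) p \<bullet> unit_normal x p) * du * dv
     + (partial_v (partial_v x) p \<bullet> unit_normal x p) * dv\<^sup>2"

definition normal_curvature :: "(real \<times> real \<Rightarrow> real^3) \<Rightarrow> real \<times> real \<Rightarrow> real \<Rightarrow> real \<Rightarrow> real" where
  "normal_curvature x p du dv = second_form x p du dv / first_form x p du dv"


subsection \<open>Ruled surfaces and their invariants\<close>

definition ruled :: "(real \<Rightarrow> real^3) \<Rightarrow> (real \<Rightarrow> real^3) \<Rightarrow> real \<times> real \<Rightarrow> real^3" where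
  "ruled s e p = s (fst p) + snd p *\<^sub>R e (fst p)"

definition conical_curvature :: "(real \<Rightarrow> real^3) \<Rightarrow> real \<Rightarrow> real" where
  "conical_curvature e u = triple_product (e u) (vderiv e u) (vderiv (vderiv e) u)"

definition param_distribution :: "(real \<Rightarrow> real^3) \<Rightarrow> (real \<Rightarrow> real^3) \<Rightarrow> real \<Rightarrow> real" where
  "param_distribution s e u = triple_product (e u) (vderiv e u) (vderiv s u)"

text \<open>The striction is the angle between \<open>e\<close> and \<open>s'\<close>, taken with the sign of the parameter of
  distribution. Its absolute value is at most \<open>pi/2\<close> when \<open>e\<close> is oriented such that
  \<open>e \<bullet> s' \<ge> 0\<close>. This orientation is not imposed, as \<open>e \<bullet> s'\<close> may change its sign; only
  the cotangent of the angle matters below, and \<open>skew_ruled_surface_striction_frame\<close> shows that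
  it is the intended quantity for every orientation.\<close>

definition striction :: "(real \<Rightarrow> real^3) \<Rightarrow> (real \<Rightarrow> real^3) \<Rightarrow> real \<Rightarrow> real" where
  "striction s e u = sgn (param_distribution s e u)
     * arccos (e u \<bullet> vderiv s u / (norm (e u) * norm (vderiv s u)))"

definition cot_striction :: "(real \<Rightarrow> real^3) \<Rightarrow> (real \<Rightarrow> real^3) \<Rightarrow> real \<Rightarrow> real" where
  "cot_striction s e u = cot (striction s e u)"

definition skew_ruled_C3_surface :: "real set \<Rightarrow> (real \<Rightarrow> real^3) \<Rightarrow> (real \<Rightarrow> real^3) \<Rightarrow> bool" where
  "skew_ruled_C3_surface I s e \<longleftrightarrow>
     I \<noteq> {} \<and> open I \<and> is_interval I
     \<and> C_k_on 3 (ruled s e) (I \<times> UNIV)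
     \<and> (\<forall>p \<in> I \<times> UNIV. cross3 (partial_u (ruled s e) p) (partial_v (ruled s e) p) \<noteq> 0)
     \<and> (\<forall>u\<in>I. norm (e u) = 1 \<and> norm (vderiv e u) = 1 \<and> vderiv s u \<bullet> vderiv e u = 0)
     \<and> (\<forall>u\<in>I. param_distribution s e u \<noteq> 0)"

text \<open>The direction \<open>du : dv\<close> is that of the orthogonal trajectory through \<open>p\<close>, i.e.
  \<open>\<delta> \<lambda> du + dv = 0\<close>.\<close>

definition orthogonal_to_ruling ::
  "(real \<Rightarrow> real^3) \<Rightarrow> (real \<Rightarrow> real^3) \<Rightarrow> real \<times> real \<Rightarrow> real \<Rightarrow> real \<Rightarrow> bool" where
  "orthogonal_to_ruling s e p du dv \<longleftrightarrow>
     (du, dv) \<noteq> (0, 0) \<and> orthogonal (tangent_vector (ruled s e) p du dv) (e (fst p))"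

definition orthoid :: "real set \<Rightarrow> (real \<Rightarrow> real^3) \<Rightarrow> (real \<Rightarrow> real^3) \<Rightarrow> bool" where
  "orthoid I s e \<longleftrightarrow> (\<forall>u\<in>I. orthogonal (e u) (vderiv s u))"

text \<open>The fixed plane is given by a normal vector \<open>p\<close>.\<close>

definition conoidal :: "real set \<Rightarrow> (real \<Rightarrow> real^3) \<Rightarrow> bool" where
  "conoidal I e \<longleftrightarrow> (\<exists>p. p \<noteq> 0 \<and> (\<forall>u\<in>I. orthogonal (e u) p))"

definition constant_param_distribution ::
  "real set \<Rightarrow> (real \<Rightarrow> real^3) \<Rightarrow> (real \<Rightarrow> real^3) \<Rightarrow> bool" where
  "constant_param_distribution I s e \<longleftrightarrow>
     (\<forall>u\<in>I. (param_distribution s e has_real_derivative 0) (at u))"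

text \<open>Up to rigid motions a ruled surface is determined by \<open>k\<close>, \<open>\<delta>\<close> and \<open>\<lambda>\<close>; the right
  helicoids are those with \<open>k = \<lambda> = \<delta>' = 0\<close>.\<close>

definition right_helicoid :: "real set \<Rightarrow> (real \<Rightarrow> real^3) \<Rightarrow> (real \<Rightarrow> real^3) \<Rightarrow> bool" where
  "right_helicoid I s e \<longleftrightarrow>
     (\<forall>u\<in>I. conical_curvature e u = 0 \<and> cot_striction s e u = 0)
     \<and> constant_param_distribution I s e"

lemma cot_arccos_divide_norm:
  fixes a d :: real
  assumes "d \<noteq> 0"
  shows "cot (sgn d * arccos (a / sqrt (a\<^sup>2 + d\<^sup>2))) = a / d"
proof -
  define r where "r = sqrt (a\<^sup>2 + d\<^sup>2)"
  have r: "r > 0" "r\<^sup>2 = a\<^sup>2 + d\<^sup>2"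
    using assms by (auto simp: r_def add_nonneg_pos)
  have "(a / r)\<^sup>2 + (d / r)\<^sup>2 = (a\<^sup>2 + d\<^sup>2) / r\<^sup>2"
    by (simp add: power_divide add_divide_distrib)
  also have "\<dots> = 1" using r(1) by (simp flip: r(2))
  finally have sum: "(a / r)\<^sup>2 + (d / r)\<^sup>2 = 1" .
  then have "(a / r)\<^sup>2 \<le> 1" using zero_le_power2[of "d / r"] by linarith
  then have c: "-1 \<le> a / r" "a / r \<le> 1" unfolding abs_square_le_1 by linarith+
  have "1 - (a / r)\<^sup>2 = (d / r)\<^sup>2" using sum by linarith
  then have sin: "sin (arccos (a / r)) = \<bar>d\<bar> / r"
    using c r(1) by (simp add: sin_arccos)
  show ?thesis
    using sin c r assms unfolding r_def[symmetric]
    by (cases "d > 0") (auto simp: cot_def sgn_if)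
qed

lemma skew_ruled_C3_surface_differentiable:
  assumes "skew_ruled_C3_surface I s e" "u \<in> I"
  shows "e differentiable (at u)"
proof -
  have "C_k_on (Suc 2) (ruled s e) (I \<times> UNIV)"
    using assms by (simp add: skew_ruled_C3_surface_def eval_nat_numeral)
  then obtain D where D: "\<And>p. p \<in> I \<times> UNIV \<Longrightarrow> (ruled s e has_derivative D p) (at p)"
    unfolding C_k_on.simps(2) by blast
  have "((\<lambda>t. ruled s e (t, v)) has_derivative (\<lambda>h. D (u, v) (h, 0))) (at u)" for v
    by (rule has_derivative_compose[OF _ D, where f = "\<lambda>t. (t, v)", simplified])
       (use assms in \<open>auto intro!: derivative_eq_intros\<close>)
  from has_derivative_diff[OF this[of 1] this[of 0]] show ?thesis
    by (auto simp: ruled_def differentiable_def)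
qed

lemma skew_ruled_surface_striction_frame:
  assumes "skew_ruled_C3_surface I s e" "u \<in> I"
  shows "vderiv s u = (param_distribution s e u * cot_striction s e u) *\<^sub>R e u
           + param_distribution s e u *\<^sub>R cross3 (e u) (vderiv e u)"
proof -
  define a t n b where "a = e u" and "t = vderiv e u" and "n = cross3 a t" and "b = vderiv s u"
  define d where "d = param_distribution s e u"
  have S: "open I" "\<forall>u\<in>I. norm (e u) = 1" "norm a = 1" "norm t = 1" "b \<bullet> t = 0" "d \<noteq> 0"
    using assms by (auto simp: skew_ruled_C3_surface_def a_def t_def b_def d_def)
  have E: "(e has_vector_derivative t) (at u)"
    using skew_ruled_C3_surface_differentiable[OF assms] vector_derivative_works t_def by blast
  have "((\<lambda>u. e u \<bullet> e u) has_vector_derivative (a \<bullet> t + t \<bullet> a)) (at u)"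
    unfolding a_def by (rule bounded_bilinear.has_vector_derivative[OF bounded_bilinear_inner E E])
  moreover have "((\<lambda>u. e u \<bullet> e u) has_vector_derivative 0) (at u)"
    by (rule has_vector_derivative_transform_within_open[OF has_vector_derivative_const[of 1] \<open>open I\<close> \<open>u \<in> I\<close>])
       (use S in \<open>auto simp: dot_square_norm\<close>)
  ultimately have at: "a \<bullet> t = 0"
    by (auto simp: inner_commute dest: vector_derivative_unique_at)
  have aa: "a \<bullet> a = 1" "t \<bullet> t = 1" using S by (simp_all add: dot_square_norm)
  have d: "d = b \<bullet> n"
    unfolding d_def param_distribution_def triple_product_def n_def a_def t_def b_def
    by (simp add: cross3_simps)
  have an: "cross3 t n = a"
    using Lagrange[of t a t] at aa by (simp add: n_def inner_commute)
  have nn: "n \<bullet> n = 1"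
    using norm_cross_dot[of a t] S at by (simp add: n_def dot_square_norm)
  have b: "b = (a \<bullet> b) *\<^sub>R a + d *\<^sub>R n"
  proof -
    have "cross3 t (cross3 b t) = b" using Lagrange[of t b t] S aa by (simp add: inner_commute)
    moreover have "cross3 b t = (a \<bullet> b) *\<^sub>R n - d *\<^sub>R a"
    proof -
      have "cross3 b t = cross3 b (cross3 n a)"
        using Lagrange[of a a t] at aa by (simp add: n_def cross_triple cross_skew[of "cross3 a t"])
      also have "\<dots> = (a \<bullet> b) *\<^sub>R n - d *\<^sub>R a" using Lagrange[of b n a] by (simp add: d inner_commute)
      finally show ?thesis .
    qed
    moreover have "cross3 t a = - n" unfolding n_def by (rule cross_skew)
    ultimately show ?thesis
      by (simp add: Cross3.right_diff_distrib cross_mult_right an)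
  qed
  have "a \<bullet> n = 0" by (simp add: n_def dot_cross_self)
  then have "b \<bullet> b = (a \<bullet> b)\<^sup>2 + d\<^sup>2"
    by (subst (1 2) b) (simp add: inner_simps aa nn inner_commute power2_eq_square)
  then have nb: "norm b = sqrt ((a \<bullet> b)\<^sup>2 + d\<^sup>2)" by (simp add: norm_eq_sqrt_inner)
  have "cot_striction s e u = (a \<bullet> b) / d"
    unfolding cot_striction_def striction_def
    using cot_arccos_divide_norm[OF \<open>d \<noteq> 0\<close>, of "a \<bullet> b"] nb S
    by (simp add: a_def b_def d_def)
  then show ?thesis using b S by (simp add: a_def b_def d_def n_def t_def)
qed

end

theory Submission
  imports Defs
begin

text \<open>In the orthonormal frame \<open>e, e', e \<times> e'\<close> the normal curvature along the orthogonal
  trajectories is \<open>- (k w\<^sup>2 + \<delta>' v + \<delta>\<^sup>2 \<lambda>) / w\<^sup>3\<close>. If it equals \<open>f w\<^sup>n\<close>, then comparing \<open>v\<close> with \<open>- v\<close>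
  gives \<open>\<delta>' = 0\<close>, and evaluating \<open>k w\<^sup>2 + \<delta>\<^sup>2 \<lambda> = - f w\<^bsup>n+3\<^esup>\<close> at \<open>w = \<bar>\<delta>\<bar>, 2 \<bar>\<delta>\<bar>, 4 \<bar>\<delta>\<bar>\<close> forces
  \<open>n = -3\<close>, \<open>n = -1\<close> or \<open>k = \<lambda> = f = 0\<close>. Since \<open>n\<close> does not depend on \<open>u\<close>, the same alternative
  holds on all of \<open>I\<close>.\<close>

section \<open>Regularity of the curves that generate a ruled map\<close>

lemma C_k_on_cong:
  assumes "C_k_on k f S" "open S" "\<And>p. p \<in> S \<Longrightarrow> f p = g p"
  shows "C_k_on k g S"
proof (cases k)
  case 0
  then show ?thesis using assms continuous_on_cong[of S S f g] by simp
next
  case (Suc m)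
  with assms(1) obtain D where D: "\<And>p. p \<in> S \<Longrightarrow> (f has_derivative D p) (at p)"
    "\<forall>h. C_k_on m (\<lambda>p. D p h) S"
    by auto
  have "(g has_derivative D p) (at p)" if "p \<in> S" for p
    by (rule has_derivative_transform_within_open[OF D(1)[OF that] assms(2) that assms(3)])
  with D(2) Suc show ?thesis by auto
qed

lemma
  assumes "(s has_vector_derivative s') (at u)" "(e has_vector_derivative e') (at u)"
  shows partial_u_ruled: "partial_u (ruled s e) (u, v) = s' + v *\<^sub>R e'"
    and has_vector_derivative_ruled:
      "((\<lambda>t. ruled s e (t, v)) has_vector_derivative s' + v *\<^sub>R e') (at u)"
proof -
  show "((\<lambda>t. ruled s e (t, v)) has_vector_derivative s' + v *\<^sub>R e') (at u)"
    unfolding ruled_def fst_conv snd_conv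
    by (rule has_vector_derivative_add[OF assms(1)
          bounded_linear.has_vector_derivative[OF bounded_linear_scaleR_right assms(2)]])
  then show "partial_u (ruled s e) (u, v) = s' + v *\<^sub>R e'"
    by (simp add: partial_u_def vector_derivative_at)
qed

text \<open>Smoothness is assumed of the surface map alone. Setting v = 0 isolates \<open>s\<close>,
  and subtracting v = 0 from v = 1 isolates \<open>e\<close>. The derivative in the direction (1, 0)
  is again a ruled map, generated by the derivatives of the two curves, so the argument can be
  iterated.\<close>

lemma C_k_on_ruled:
  assumes "C_k_on (Suc k) (ruled s e) (I \<times> UNIV)" "open I"
  shows "\<And>u. u \<in> I \<Longrightarrow> (s has_vector_derivative vderiv s u) (at u)"
    and "\<And>u. u \<in> I \<Longrightarrow> (e has_vector_derivative vderiv e u) (at u)"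
    and "C_k_on k (ruled (vderiv s) (vderiv e)) (I \<times> UNIV)"
proof -
  obtain D where D: "\<And>p. p \<in> I \<times> UNIV \<Longrightarrow> (ruled s e has_derivative D p) (at p)"
    and C: "\<And>h. C_k_on k (\<lambda>p. D p h) (I \<times> UNIV)"
    using assms(1) unfolding C_k_on.simps(2) by blast
  have *: "((\<lambda>t. ruled s e (t, v)) has_derivative (\<lambda>h. D (u, v) (h, 0))) (at u)" if "u \<in> I" for u v
    by (rule has_derivative_compose[OF _ D, where f = "\<lambda>t. (t, v)", simplified])
       (use that in \<open>auto intro!: derivative_eq_intros\<close>)
  have ds: "s differentiable (at u)" if "u \<in> I" for u
    using *[OF that, of 0] by (auto simp: ruled_def differentiable_def)
  have de: "e differentiable (at u)" if "u \<in> I" for u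
    using has_derivative_diff[OF *[OF that, of 1] *[OF that, of 0]]
    by (auto simp: ruled_def differentiable_def)
  show s: "(s has_vector_derivative vderiv s u) (at u)" if "u \<in> I" for u
    using ds[OF that] vector_derivative_works by blast
  show e: "(e has_vector_derivative vderiv e u) (at u)" if "u \<in> I" for u
    using de[OF that] vector_derivative_works by blast
  \<comment> \<open>\<open>D\<close> is an arbitrary witness of differentiability; uniqueness of the
    derivative along the line t -> (t, v) identifies its value.\<close>
  have "D p (1, 0) = ruled (vderiv s) (vderiv e) p" if "p \<in> I \<times> UNIV" for p
  proof -
    obtain u v where p: "p = (u, v)" "u \<in> I" using \<open>p \<in> I \<times> UNIV\<close> by auto
    have "((\<lambda>t. ruled s e (t, v)) has_vector_derivative vderiv s u + v *\<^sub>R vderiv e u) (at u)"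
      by (rule has_vector_derivative_ruled[OF s[OF p(2)] e[OF p(2)]])
    then have "(\<lambda>h. D (u, v) (h, 0)) = (\<lambda>h. h *\<^sub>R (vderiv s u + v *\<^sub>R vderiv e u))"
      using has_derivative_unique[OF *[OF p(2)]] by (simp add: has_vector_derivative_def)
    from fun_cong[OF this, of 1] show ?thesis by (simp add: p ruled_def)
  qed
  then show "C_k_on k (ruled (vderiv s) (vderiv e)) (I \<times> UNIV)"
    by (intro C_k_on_cong[OF C[of "(1, 0)"]]) (auto simp: assms(2) open_Times)
qed

section \<open>Calculus of vector-valued curves\<close>

lemma vector_derivative_affine: "vderiv (\<lambda>t. a + t *\<^sub>R b) v = b"
  by (rule vector_derivative_at) (auto intro!: derivative_eq_intros)

lemma partial_v_ruled: "partial_v (ruled s e) p = e (fst p)"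
  by (simp add: partial_v_def ruled_def vector_derivative_affine)

text \<open>Serves to differentiate relations such as <e, e> = 1, which are known only on
  \<open>I\<close>; openness of \<open>I\<close> makes this legitimate.\<close>

lemma has_vector_derivative_eq_0_if_locally_constant:
  assumes "(f has_vector_derivative f') (at u)" "open I" "u \<in> I" "\<And>t. t \<in> I \<Longrightarrow> f t = c"
  shows "f' = 0"
proof -
  have "(f has_vector_derivative 0) (at u)"
    by (rule has_vector_derivative_transform_within_open[OF has_vector_derivative_const[of c]])
       (use assms in auto)
  with assms(1) show ?thesis by (rule vector_derivative_unique_at)
qed

lemma has_vector_derivative_cross3:
  assumes "(f has_vector_derivative f') (at u)" "(g has_vector_derivative g') (at u)"
  shows "((\<lambda>t. cross3 (f t) (g t)) has_vector_derivative cross3 (f u) g' + cross3 f' (g u)) (at u)"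
  by (rule bounded_bilinear.has_vector_derivative[OF _ assms])
     (simp add: bilinear_conv_bounded_bilinear[symmetric] bilinear_cross)

lemma has_vector_derivative_inner:
  assumes "(f has_vector_derivative f') (at u)" "(g has_vector_derivative g') (at u)"
  shows "((\<lambda>t. f t \<bullet> g t) has_vector_derivative f u \<bullet> g' + f' \<bullet> g u) (at u)"
  by (rule bounded_bilinear.has_vector_derivative[OF bounded_bilinear_inner assms])

section \<open>Integer powers against even quadratic polynomials\<close>

lemma power_int_inject:
  fixes a :: "'a::linordered_field"
  assumes "a > 1" "a powi m = a powi n"
  shows "m = n"
  using assms power_int_strict_increasing[of m n a] power_int_strict_increasing[of n m a]
  by (metis less_irrefl linorder_neqE)

lemma vanishing_on_powers_of_2:
  fixes A B C r :: real and m :: int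
  assumes "r > 0" "\<And>w. w \<ge> r \<Longrightarrow> A + B * w\<^sup>2 = C * w powi m"
  obtains "m = 0" "B = 0" "A = C"
    | "m = 2" "A = 0" "B = C"
    | "A = 0" "B = 0" "C = 0"
proof -
  define t :: real where "t = 2 powi m"
  define R where "R = r powi m"
  have R: "R > 0" using assms(1) by (simp add: R_def zero_less_power_int)
  have t4: "4 powi m = t\<^sup>2"
    using power_int_mult_distrib[of "2::real" 2 m] by (simp add: t_def power2_eq_square)
  have eq1: "A + B * r\<^sup>2 = C * R" using assms(2)[of r] by (simp add: R_def)
  have eq2: "A + 4 * (B * r\<^sup>2) = C * R * t"
    using assms(2)[of "2 * r"] assms(1) by (simp add: R_def t_def power_int_mult_distrib algebra_simps)
  have eq3: "A + 16 * (B * r\<^sup>2) = C * R * t\<^sup>2"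
    using assms(2)[of "4 * r"] assms(1) t4 by (simp add: R_def power_int_mult_distrib algebra_simps)
  \<comment> \<open>The combination \<open>eq3\<close> - 5 \<open>eq2\<close> + 4 \<open>eq1\<close>
    eliminates \<open>A\<close> and \<open>B\<close>, and t^2 - 5 t + 4 = (t - 1)(t - 4). The roots
    1 and 4 are the values of 2^m at m = 0 and m = 2.\<close>
  have "C * R * ((t - 1) * (t - 4)) = 0" using eq1 eq2 eq3 by algebra
  then consider "t = 1" | "t = 4" | "C = 0" using R by auto
  then show ?thesis
  proof cases
    case 1
    then have m: "m = 0" using power_int_inject[of 2 m 0] by (simp add: t_def)
    have "B * r\<^sup>2 = 0" using eq1 eq2 unfolding 1 by linarith
    then have "B = 0" using assms(1) by simp
    with m eq1 show ?thesis using that(1) by (simp add: R_def)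
  next
    case 2
    then have m: "m = 2" using power_int_inject[of 2 m 2] by (simp add: t_def)
    have "A = 0" using eq1 eq2 unfolding 2 by linarith
    with m eq1 show ?thesis using that(2) assms(1) by (simp add: R_def)
  next
    case 3
    have "A = 0" "B * r\<^sup>2 = 0" using eq1 eq2 unfolding 3 by linarith+
    with 3 show ?thesis using that(3) assms(1) by simp
  qed
qed

section \<open>The moving frame along the striction line\<close>

context
  fixes I :: "real set" and s e :: "real \<Rightarrow> real^3"
  assumes surface: "skew_ruled_C3_surface I s e"
begin

private abbreviation (input) "k \<equiv> conical_curvature e"
private abbreviation (input) "\<delta> \<equiv> param_distribution s e"
private abbreviation (input) "l \<equiv> cot_striction s e"
private abbreviation (input) "nrm u \<equiv> cross3 (e u) (vderiv e u)"

lemma skew_ruled_surface_unfold: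
  shows "open I" "is_interval I" "I \<noteq> {}"
    and "u \<in> I \<Longrightarrow> norm (e u) = 1" "u \<in> I \<Longrightarrow> norm (vderiv e u) = 1"
    and "u \<in> I \<Longrightarrow> vderiv s u \<bullet> vderiv e u = 0" "u \<in> I \<Longrightarrow> \<delta> u \<noteq> 0"
  using surface by (auto simp: skew_ruled_C3_surface_def)

lemma skew_ruled_surface_derivatives:
  assumes "u \<in> I"
  shows "(s has_vector_derivative vderiv s u) (at u)"
    and "(e has_vector_derivative vderiv e u) (at u)"
    and "(vderiv s has_vector_derivative vderiv (vderiv s) u) (at u)"
    and "(vderiv e has_vector_derivative vderiv (vderiv e) u) (at u)"
proof -
  \<comment> \<open>The order 3 is split so that \<open>C_k_on_ruled\<close> applies twice, first to
    \<open>s\<close> and \<open>e\<close>, then to their derivatives.\<close>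
  have C: "C_k_on (Suc (Suc 1)) (ruled s e) (I \<times> UNIV)"
    using surface by (simp add: skew_ruled_C3_surface_def eval_nat_numeral)
  note r = C_k_on_ruled[OF C skew_ruled_surface_unfold(1)]
  note r' = C_k_on_ruled[OF r(3) skew_ruled_surface_unfold(1)]
  show "(s has_vector_derivative vderiv s u) (at u)"
    "(e has_vector_derivative vderiv e u) (at u)"
    "(vderiv s has_vector_derivative vderiv (vderiv s) u) (at u)"
    "(vderiv e has_vector_derivative vderiv (vderiv e) u) (at u)"
    using r(1,2) r'(1,2) assms by auto
qed

lemma striction_frame_orthonormal:
  assumes "u \<in> I"
  shows "e u \<bullet> e u = 1" "vderiv e u \<bullet> vderiv e u = 1" "e u \<bullet> vderiv e u = 0"
    "nrm u \<bullet> nrm u = 1" "e u \<bullet> nrm u = 0" "vderiv e u \<bullet> nrm u = 0"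
    "cross3 (e u) (nrm u) = - vderiv e u"
proof -
  note D = skew_ruled_surface_derivatives(2)[OF assms]
  show ee: "e u \<bullet> e u = 1" "vderiv e u \<bullet> vderiv e u = 1"
    using skew_ruled_surface_unfold(4,5)[OF assms] by (simp_all add: dot_square_norm)
  have "e u \<bullet> vderiv e u + vderiv e u \<bullet> e u = 0"
    by (rule has_vector_derivative_eq_0_if_locally_constant[OF has_vector_derivative_inner[OF D D]
          skew_ruled_surface_unfold(1) assms, of 1])
       (simp add: skew_ruled_surface_unfold dot_square_norm)
  then show et: "e u \<bullet> vderiv e u = 0" by (simp add: inner_commute)
  show "nrm u \<bullet> nrm u = 1"
    using norm_cross_dot[of "e u" "vderiv e u"] et skew_ruled_surface_unfold(4,5)[OF assms]
    by (simp add: dot_square_norm)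
  show "e u \<bullet> nrm u = 0" "vderiv e u \<bullet> nrm u = 0" by (simp_all add: dot_cross_self)
  show "cross3 (e u) (nrm u) = - vderiv e u"
    using Lagrange[of "e u" "e u" "vderiv e u"] ee et by simp
qed

text \<open>Differentiating <e', e'> = 1 and <e, e'> = 0 gives the components 0 along e' and -1
  along e; the component along e x e' is \<open>k\<close> by definition of the triple
  product.\<close>

lemma second_derivative_in_frame:
  assumes "u \<in> I"
  shows "vderiv (vderiv e) u = - e u + k u *\<^sub>R nrm u"
proof -
  define a t b where "a = e u" and "t = vderiv e u" and "b = vderiv (vderiv e) u"
  note D = skew_ruled_surface_derivatives[OF assms]
  note O = striction_frame_orthonormal[OF assms, folded a_def t_def]
  have "t \<bullet> b + b \<bullet> t = 0" unfolding t_def b_def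
    by (rule has_vector_derivative_eq_0_if_locally_constant[OF has_vector_derivative_inner[OF D(4,4)]
          skew_ruled_surface_unfold(1) assms, of 1])
       (simp add: skew_ruled_surface_unfold dot_square_norm)
  then have tb: "b \<bullet> t = 0" by (simp add: inner_commute)
  have "a \<bullet> b + t \<bullet> t = 0" unfolding a_def t_def b_def
    by (rule has_vector_derivative_eq_0_if_locally_constant[OF has_vector_derivative_inner[OF D(2,4)]
          skew_ruled_surface_unfold(1) assms, of 0])
       (simp add: striction_frame_orthonormal)
  then have ab: "a \<bullet> b = - 1" using O by simp
  have kb: "k u = b \<bullet> cross3 a t"
    unfolding conical_curvature_def triple_product_def a_def t_def b_def by (simp add: cross3_simps)
  \<comment> \<open>Since b is orthogonal to the unit vector t, it is recovered from b x t. This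
    takes the place of an expansion in the orthonormal basis.\<close>
  have "cross3 t (cross3 b t) = b" using Lagrange[of t b t] O tb by (simp add: inner_commute)
  moreover have "cross3 b t = - cross3 a t - k u *\<^sub>R a"
  proof -
    have "cross3 b t = cross3 b (cross3 (cross3 a t) a)"
      using O(7) by (simp add: cross_skew[of "cross3 a t" a])
    also have "\<dots> = - cross3 a t - k u *\<^sub>R a"
      using Lagrange[of b "cross3 a t" a] ab kb by (simp add: inner_commute)
    finally show ?thesis .
  qed
  moreover have "cross3 t (cross3 a t) = a" using Lagrange[of t a t] O by (simp add: inner_commute)
  moreover have "cross3 t a = - cross3 a t" by (rule cross_skew)
  ultimately have "b = - a + k u *\<^sub>R cross3 a t"
    by (simp add: Cross3.right_diff_distrib cross_mult_right cross_minus_right)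
  then show ?thesis by (simp add: a_def t_def b_def)
qed

text \<open>The product rule leaves only e x e'', and inserting e'' = -e + k (e x e') yields -k
  e'.\<close>

lemma has_vector_derivative_frame_normal:
  assumes "u \<in> I"
  shows "((\<lambda>u. nrm u) has_vector_derivative - k u *\<^sub>R vderiv e u) (at u)"
  using has_vector_derivative_cross3[OF skew_ruled_surface_derivatives(2,4)[OF assms]]
  by (simp add: second_derivative_in_frame[OF assms] Cross3.right_diff_distrib
      cross_mult_right striction_frame_orthonormal[OF assms])

text \<open>In the derivative of <s', e x e'> the term containing (e x e')' is a multiple of <s',
  e'>, which vanishes on the striction line.\<close>

lemma has_real_derivative_param_distribution:
  assumes "u \<in> I"
  shows "(\<delta> has_real_derivative vderiv (vderiv s) u \<bullet> nrm u) (at u)"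
proof -
  have "\<delta> = (\<lambda>u. vderiv s u \<bullet> nrm u)"
    unfolding param_distribution_def triple_product_def by (auto simp: cross3_simps)
  then show ?thesis
    using has_vector_derivative_inner[OF skew_ruled_surface_derivatives(3)[OF assms]
        has_vector_derivative_frame_normal[OF assms]] skew_ruled_surface_unfold(6)[OF assms]
    by (simp add: has_real_derivative_iff_has_vector_derivative)
qed

text \<open>The component of s'' along e' comes from differentiating <s', e'> = 0 and inserting the
  frame formula for e''; this avoids differentiating \<open>l\<close>.\<close>

lemma striction_derivative_components:
  assumes "u \<in> I"
  shows "vderiv s u = (\<delta> u * l u) *\<^sub>R e u + \<delta> u *\<^sub>R nrm u"
    and "vderiv (vderiv s) u \<bullet> vderiv e u = \<delta> u * l u - \<delta> u * k u"
proof -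
  show F: "vderiv s u = (\<delta> u * l u) *\<^sub>R e u + \<delta> u *\<^sub>R nrm u"
    by (rule skew_ruled_surface_striction_frame[OF surface assms])
  have "vderiv s u \<bullet> vderiv (vderiv e) u + vderiv (vderiv s) u \<bullet> vderiv e u = 0"
    by (rule has_vector_derivative_eq_0_if_locally_constant[OF
          has_vector_derivative_inner[OF skew_ruled_surface_derivatives(3,4)[OF assms]]
          skew_ruled_surface_unfold(1) assms, of 0])
       (simp add: skew_ruled_surface_unfold)
  moreover have "vderiv s u \<bullet> vderiv (vderiv e) u = \<delta> u * k u - \<delta> u * l u"
    using striction_frame_orthonormal[OF assms]
    by (simp add: F second_derivative_in_frame[OF assms] inner_simps inner_commute)
  ultimately show "vderiv (vderiv s) u \<bullet> vderiv e u = \<delta> u * l u - \<delta> u * k u" by simp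
qed

section \<open>Fundamental forms and normal curvature\<close>

lemma skew_ruled_surface_partials:
  assumes "u \<in> I"
  shows "partial_u (ruled s e) (u, v) = (\<delta> u * l u) *\<^sub>R e u + \<delta> u *\<^sub>R nrm u + v *\<^sub>R vderiv e u"
    and "partial_v (ruled s e) (u, v) = e u"
    and "partial_u (partial_u (ruled s e)) (u, v) = vderiv (vderiv s) u + v *\<^sub>R vderiv (vderiv e) u"
    and "partial_v (partial_u (ruled s e)) (u, v) = vderiv e u"
    and "partial_v (partial_v (ruled s e)) (u, v) = 0"
proof -
  note D = skew_ruled_surface_derivatives
  \<comment> \<open>Stated for every t in \<open>I\<close>, because the second partial derivative
    requires the first one on a neighbourhood of u.\<close>
  have pu: "partial_u (ruled s e) (t, v) = ruled (vderiv s) (vderiv e) (t, v)" if "t \<in> I" for t v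
    using partial_u_ruled[OF D(1,2)[OF that]] by (simp add: ruled_def)
  show "partial_u (ruled s e) (u, v) = (\<delta> u * l u) *\<^sub>R e u + \<delta> u *\<^sub>R nrm u + v *\<^sub>R vderiv e u"
    using pu[OF assms] striction_derivative_components(1)[OF assms] by (simp add: ruled_def)
  show "partial_v (ruled s e) (u, v) = e u" by (simp add: partial_v_ruled)
  have "((\<lambda>t. partial_u (ruled s e) (t, v)) has_vector_derivative
      vderiv (vderiv s) u + v *\<^sub>R vderiv (vderiv e) u) (at u)"
    by (rule has_vector_derivative_transform_within_open[OF has_vector_derivative_ruled[OF
          D(3,4)[OF assms]] skew_ruled_surface_unfold(1) assms])
       (simp add: pu)
  then show "partial_u (partial_u (ruled s e)) (u, v)
      = vderiv (vderiv s) u + v *\<^sub>R vderiv (vderiv e) u"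
    by (simp add: partial_u_def[of "partial_u _"] vector_derivative_at)
  show "partial_v (partial_u (ruled s e)) (u, v) = vderiv e u"
    by (simp add: partial_v_def pu[OF assms] ruled_def vector_derivative_affine)
  show "partial_v (partial_v (ruled s e)) (u, v) = 0"
    by (simp add: partial_v_def[of "partial_v _"] partial_v_ruled)
qed

lemma unit_normal_skew_ruled_surface:
  assumes "u \<in> I"
  shows "unit_normal (ruled s e) (u, v)
    = (\<delta> u *\<^sub>R vderiv e u - v *\<^sub>R nrm u) /\<^sub>R sqrt (v\<^sup>2 + (\<delta> u)\<^sup>2)"
proof -
  note O = striction_frame_orthonormal[OF assms]
  have c: "cross3 (partial_u (ruled s e) (u, v)) (partial_v (ruled s e) (u, v))
      = \<delta> u *\<^sub>R vderiv e u - v *\<^sub>R nrm u" (is "_ = ?N")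
    using O(7) cross_skew[of "nrm u" "e u"] cross_skew[of "vderiv e u" "e u"]
    by (simp add: skew_ruled_surface_partials[OF assms] cross_add_left cross_mult_left)
  have "?N \<bullet> ?N = v\<^sup>2 + (\<delta> u)\<^sup>2"
    using O by (simp add: inner_simps inner_commute power2_eq_square)
  then show ?thesis unfolding unit_normal_def c by (simp add: norm_eq_sqrt_inner)
qed

lemma orthogonal_trajectory_direction:
  assumes "u \<in> I"
  shows "orthogonal_to_ruling s e (u, v) 1 (- (\<delta> u * l u))"
  using striction_frame_orthonormal[OF assms]
  by (simp add: orthogonal_to_ruling_def orthogonal_def tangent_vector_def inner_simps
      skew_ruled_surface_partials[OF assms] inner_commute)

text \<open>The tangent vector in this direction is \<delta> (e x e') + v e', of squared length w^2.
  Up to the factor 1/w, the du^2 term of the second form contributes -k v^2 - \<delta>' v +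
  \<delta>^2 (l - k) and the mixed term -2 \<delta>^2 l; in the sum, \<open>k\<close> is multiplied
  exactly by w^2.\<close>

lemma normal_curvature_orthogonal_trajectory:
  assumes "u \<in> I"
  shows "normal_curvature (ruled s e) (u, v) 1 (- (\<delta> u * l u))
    = - (k u * (v\<^sup>2 + (\<delta> u)\<^sup>2) + (vderiv (vderiv s) u \<bullet> nrm u) * v + (\<delta> u)\<^sup>2 * l u)
        / sqrt (v\<^sup>2 + (\<delta> u)\<^sup>2) ^ 3"
proof -
  note O = striction_frame_orthonormal[OF assms]
  define w where "w = sqrt (v\<^sup>2 + (\<delta> u)\<^sup>2)"
  have w: "w > 0" "w\<^sup>2 = v\<^sup>2 + (\<delta> u)\<^sup>2"
    using skew_ruled_surface_unfold(7)[OF assms] by (auto simp: w_def add_nonneg_pos)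
  have 1: "first_form (ruled s e) (u, v) 1 (- (\<delta> u * l u)) = w\<^sup>2"
    unfolding w(2) using O
    by (simp add: first_form_def tangent_vector_def skew_ruled_surface_partials[OF assms]
        inner_simps inner_commute power2_eq_square)
  have 2: "second_form (ruled s e) (u, v) 1 (- (\<delta> u * l u))
      = - (k u * w\<^sup>2 + (vderiv (vderiv s) u \<bullet> nrm u) * v + (\<delta> u)\<^sup>2 * l u) / w"
    using O w(1) striction_derivative_components(2)[OF assms] unfolding w(2)
    by (simp add: second_form_def unit_normal_skew_ruled_surface[OF assms, of v, folded w_def]
        skew_ruled_surface_partials[OF assms] inner_simps inner_commute
        second_derivative_in_frame[OF assms])
       (simp add: field_simps power2_eq_square)
  show ?thesis
    unfolding normal_curvature_def 1 2 w_def[symmetric] w(2)[symmetric]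
    using w(1) by (simp add: power2_eq_square power3_eq_cube)
qed

section \<open>Geometric meaning of k = 0 and l = 0\<close>

text \<open>For k = 0 the vector e x e' has derivative zero, so it is constant on the interval and
  is a normal of the plane to which all rulings are parallel.\<close>

lemma conoidal_if_conical_curvature_eq_0:
  assumes "\<And>u. u \<in> I \<Longrightarrow> k u = 0"
  shows "conoidal I e"
proof -
  have "convex I" using skew_ruled_surface_unfold(2) is_interval_convex by blast
  moreover have "((\<lambda>u. nrm u) has_vector_derivative 0) (at u within I)" if "u \<in> I" for u
    using has_vector_derivative_frame_normal[OF that] assms[OF that]
    by (auto intro: has_vector_derivative_at_within)
  ultimately obtain c where c: "\<And>u. u \<in> I \<Longrightarrow> nrm u = c"
    by (rule has_vector_derivative_zero_constant[of I "\<lambda>u. nrm u"]) blast+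
  obtain u where u: "u \<in> I" using skew_ruled_surface_unfold(3) by auto
  have "c \<noteq> 0" using striction_frame_orthonormal(4)[OF u] c[OF u] by auto
  moreover have "orthogonal (e u) c" if "u \<in> I" for u
    using striction_frame_orthonormal(5)[OF that] c[OF that] by (simp add: orthogonal_def)
  ultimately show ?thesis unfolding conoidal_def by blast
qed

lemma orthoid_if_cot_striction_eq_0:
  assumes "\<And>u. u \<in> I \<Longrightarrow> l u = 0"
  shows "orthoid I s e"
  unfolding orthoid_def orthogonal_def
  using assms striction_derivative_components(1) striction_frame_orthonormal(5) by simp

end

section \<open>Classification by the exponent\<close>

theorem proposition5:
  fixes I :: "real set" and s e :: "real \<Rightarrow> real^3" and f :: "real \<Rightarrow> real" and n :: int
  assumes surface: "skew_ruled_C3_surface I s e"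
    and cont: "continuous_on I f"
    and kN: "\<And>u v du dv. u \<in> I \<Longrightarrow> orthogonal_to_ruling s e (u, v) du dv \<Longrightarrow>
      normal_curvature (ruled s e) (u, v) du dv
        = f u * sqrt (v\<^sup>2 + (param_distribution s e u)\<^sup>2) powi n"
  shows "((\<forall>u\<in>I. f u = 0) \<and> right_helicoid I s e)
    \<or> (n = -3 \<and> (\<forall>u\<in>I. f u = - ((param_distribution s e u)\<^sup>2 * cot_striction s e u))
        \<and> conoidal I e \<and> constant_param_distribution I s e)
    \<or> (n = -1 \<and> (\<forall>u\<in>I. f u = - conical_curvature e u)
        \<and> orthoid I s e \<and> constant_param_distribution I s e)"
proof -
  define k \<delta> l \<delta>' where "k = conical_curvature e" and "\<delta> = param_distribution s e"
    and "l = cot_striction s e"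
    and "\<delta>' u = vderiv (vderiv s) u \<bullet> cross3 (e u) (vderiv e u)" for u
  have eq: "k u * (v\<^sup>2 + (\<delta> u)\<^sup>2) + \<delta>' u * v + (\<delta> u)\<^sup>2 * l u
      = - f u * sqrt (v\<^sup>2 + (\<delta> u)\<^sup>2) powi (n + 3)" if "u \<in> I" for u v
  proof -
    define w where "w = sqrt (v\<^sup>2 + (\<delta> u)\<^sup>2)"
    have w: "w > 0"
      using skew_ruled_surface_unfold(7)[OF surface that] by (auto simp: w_def \<delta>_def add_nonneg_pos)
    have "- (k u * (v\<^sup>2 + (\<delta> u)\<^sup>2) + \<delta>' u * v + (\<delta> u)\<^sup>2 * l u) / w ^ 3 = f u * w powi n"
      using kN[OF that orthogonal_trajectory_direction[OF surface that]]
        normal_curvature_orthogonal_trajectory[OF surface that, of v]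
      by (simp add: k_def \<delta>_def l_def \<delta>'_def w_def)
    moreover have "w powi (n + 3) = w powi n * w ^ 3" using w by (simp add: power_int_add)
    ultimately show ?thesis using w unfolding w_def[symmetric] by (simp add: field_simps)
  qed
  have \<delta>': "\<delta>' u = 0" if "u \<in> I" for u
    using eq[OF that, of 1] eq[OF that, of "- 1"] by simp
  then have const: "constant_param_distribution I s e"
    unfolding constant_param_distribution_def
    using has_real_derivative_param_distribution[OF surface] by (metis \<delta>'_def)
  have cases: "(n = -3 \<and> k u = 0 \<and> f u = - ((\<delta> u)\<^sup>2 * l u)) \<or> (n = -1 \<and> l u = 0 \<and> f u = - k u)
      \<or> (k u = 0 \<and> l u = 0 \<and> f u = 0)" if "u \<in> I" for u
  proof -
    have d: "\<bar>\<delta> u\<bar> > 0" using skew_ruled_surface_unfold(7)[OF surface that] by (simp add: \<delta>_def)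
    \<comment> \<open>Every w \<ge> |\<delta>| is attained at v = sqrt (w^2 - \<delta>^2), so the
      identity in v becomes one in w alone.\<close>
    have "(\<delta> u)\<^sup>2 * l u + k u * w\<^sup>2 = - f u * w powi (n + 3)" if "w \<ge> \<bar>\<delta> u\<bar>" for w
    proof -
      have "w\<^sup>2 \<ge> (\<delta> u)\<^sup>2" using that by (metis abs_le_square_iff abs_ge_self order_trans)
      then show ?thesis
        using eq[OF \<open>u \<in> I\<close>, of "sqrt (w\<^sup>2 - (\<delta> u)\<^sup>2)"] \<delta>'[OF \<open>u \<in> I\<close>] that d by simp
    qed
    \<comment> \<open>Here m = n + 3, so m = 0 and m = 2 become n = -3 and n = -1; C is -f, and
      \<delta> \<noteq> 0 turns \<delta>^2 l = 0 into l = 0.\<close>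
    from vanishing_on_powers_of_2[OF d this] show ?thesis
      by cases (use d in auto)
  qed
  \<comment> \<open>The alternative in \<open>cases\<close> might vary with u, but n is fixed. For n
    = -3 or n = -1 the points with k = l = f = 0 satisfy the equations of the respective case as
    well; any other n leaves only such points.\<close>
  consider "n = -3" | "n = -1" | "n \<noteq> -3" "n \<noteq> -1" by blast
  then show ?thesis
  proof cases
    case 1
    then have "\<forall>u\<in>I. k u = 0 \<and> f u = - ((\<delta> u)\<^sup>2 * l u)" using cases by force
    with 1 const conoidal_if_conical_curvature_eq_0[OF surface] show ?thesis
      by (auto simp: k_def \<delta>_def l_def)
  next
    case 2
    then have "\<forall>u\<in>I. l u = 0 \<and> f u = - k u" using cases by force
    with 2 const orthoid_if_cot_striction_eq_0[OF surface] show ?thesis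
      by (auto simp: k_def l_def)
  next
    case 3
    then have "\<forall>u\<in>I. k u = 0 \<and> l u = 0 \<and> f u = 0" using cases by blast
    with const show ?thesis by (auto simp: right_helicoid_def k_def l_def)
  qed
qed

end
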